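(* The Apollonian weak metric $\delta_{\mathbb{D}^2}$ of the open unit disk $\mathbb{D}^2=\{z\in\mathbb{C}:|z|<1\}$ is not invariant under the group of Möbius transformations preserving the unit disk; that is, there exist a Möbius transformation $g$ with $g(\mathbb{D}^2)=\mathbb{D}^2$ and points $x,y\in\mathbb{D}^2$ such that $\delta_{\mathbb{D}^2}(g(x),g(y))\neq\delta_{\mathbb{D}^2}(x,y)$.
   Context: The Apollonian weak metric of the unit disk is $\delta_{\mathbb{D}^2}(x,y)=\sup_{|a|=1}\log\frac{|x-a|}{|y-a|}$ for $x,y\in\mathbb{D}^2$. *)

theory Defs
  imports "HOL-Analysis.Analysis"
begin

(* The supremum is taken in the reals; for points of the open unit disk the set is
   bounded above (bdd_above_apollonian below) and nonempty, so it is a genuine supremum. *)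
definition apollonian_disk :: "complex \<Rightarrow> complex \<Rightarrow> real" where
  "apollonian_disk x y = (SUP a\<in>sphere 0 1. ln (norm (x - a) / norm (y - a)))"

lemma bdd_above_apollonian:
  fixes x y :: complex
  assumes "x \<in> ball 0 1" "y \<in> ball 0 1"
  shows "bdd_above ((\<lambda>a. ln (norm (x - a) / norm (y - a))) ` sphere 0 1)"
proof -
  have "continuous_on (sphere 0 1) (\<lambda>a. ln (norm (x - a) / norm (y - a)))"
    using assms by (intro continuous_intros) auto
  then have "compact ((\<lambda>a. ln (norm (x - a) / norm (y - a))) ` sphere 0 1)"
    by (rule compact_continuous_image) simp
  then show ?thesis
    by (intro bounded_imp_bdd_above compact_imp_bounded)
qed

(* The finite part of a Moebius transformation of the Riemann sphere. At the pole the
   value would be the point at infinity, so the complex number g z is unconstrained there.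
   This admits nothing new when g is required to map the unit disk onto itself: a map with
   a pole in the disk is unbounded on the disk. *)
definition moebius_transformation :: "(complex \<Rightarrow> complex) \<Rightarrow> bool" where
  "moebius_transformation g \<longleftrightarrow>
     (\<exists>a b c d. a * d - b * c \<noteq> 0 \<and>
        (\<forall>z. c * z + d \<noteq> 0 \<longrightarrow> g z = (a * z + b) / (c * z + d)))"

end

theory Submission imports Defs begin

text \<open>The weak metric is not symmetric: for \<open>0 < r < 1\<close> it is \<open>ln (1 + r)\<close> from \<open>r\<close> to \<open>0\<close> and
  \<open>- ln (1 - r)\<close> from \<open>0\<close> to \<open>r\<close>. But the disk automorphism \<open>z \<mapsto> (r - z) / (1 - r z)\<close> swaps
  \<open>0\<close> and \<open>r\<close>, so it cannot preserve the weak metric. Here \<open>r = 1/2\<close>.\<close>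

text \<open>For \<open>a\<close> on the unit circle the denominator is 1, and the triangle
  inequality bounds the numerator.\<close>

lemma apollonian_disk_to_zero_le:
  assumes "x \<in> ball 0 1"
  shows "apollonian_disk x 0 \<le> ln (1 + norm x)"
  unfolding apollonian_disk_def
proof (rule cSUP_least)
  fix a :: complex
  assume a: "a \<in> sphere 0 1"
  have "0 < norm (x - a)"
    using assms a by auto
  then show "ln (norm (x - a) / norm (0 - a)) \<le> ln (1 + norm x)"
    using a norm_triangle_ineq4[of x a] by (simp add: ln_mono add.commute)
qed simp

lemma apollonian_disk_from_zero_ge:
  assumes "y \<in> ball 0 1" "a \<in> sphere 0 1"
  shows "- ln (norm (y - a)) \<le> apollonian_disk 0 y"
proof -
  have "0 < norm (y - a)"
    using assms by auto
  then have "- ln (norm (y - a)) = ln (norm (0 - a) / norm (y - a))"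
    using assms(2) by (simp add: ln_div)
  also have "\<dots> \<le> apollonian_disk 0 y"
    unfolding apollonian_disk_def
    by (rule cSUP_upper[OF assms(2) bdd_above_apollonian]) (use assms(1) in auto)
  finally show ?thesis .
qed

text \<open>The map \<open>(r - z) / (1 - r * z)\<close> at \<open>r = 1/2\<close>, with the
  fraction expanded by 2.\<close>

definition disk_swap :: "complex \<Rightarrow> complex" where
  "disk_swap z = (1 - 2 * z) / (2 - z)"

lemma moebius_disk_swap: "moebius_transformation disk_swap"
  unfolding moebius_transformation_def disk_swap_def
  by (rule exI[of _ "-2"], rule exI[of _ 1], rule exI[of _ "-1"], rule exI[of _ 2]) simp

lemma disk_swap_in_ball:
  assumes "z \<in> ball 0 1"
  shows "disk_swap z \<in> ball 0 1"
proof -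
  have "(norm z)\<^sup>2 < 1"
    using assms by (simp add: power_less_one_iff)
  \<comment> \<open>The right side minus the left is
    \<open>3 * (1 - (norm z)\<^sup>2)\<close>.\<close>
  then have "(norm (1 - 2 * z))\<^sup>2 < (norm (2 - z))\<^sup>2"
    by (simp add: cmod_power2) (simp add: power2_eq_square algebra_simps)
  then have "norm (1 - 2 * z) < norm (2 - z)"
    by (rule power2_less_imp_less) simp
  then show ?thesis
    by (simp add: disk_swap_def norm_divide divide_less_eq)
qed

text \<open>At the pole, division by zero gives \<open>disk_swap 2 = 0\<close>, which is then sent
  to \<open>1/2\<close>.\<close>

lemma disk_swap_disk_swap:
  assumes "z \<noteq> 2"
  shows "disk_swap (disk_swap z) = z"
proof -
  have *: "2 - z \<noteq> 0"
    using assms by simp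
  have "1 - 2 * disk_swap z = - 3 * (- z) / (2 - z)" "2 - disk_swap z = 3 / (2 - z)"
    using * by (simp_all add: disk_swap_def field_simps)
  then show ?thesis
    using * by (simp add: disk_swap_def[of "disk_swap z"])
qed

text \<open>An involution that maps the disk into itself maps it onto itself.\<close>

lemma disk_swap_image_ball: "disk_swap ` ball 0 1 = ball 0 1"
proof
  show "disk_swap ` ball 0 1 \<subseteq> ball 0 1"
    using disk_swap_in_ball by blast
  show "ball 0 1 \<subseteq> disk_swap ` ball 0 1"
  proof
    fix z :: complex
    assume z: "z \<in> ball 0 1"
    then have "z = disk_swap (disk_swap z)"
      by (subst disk_swap_disk_swap) auto
    then show "z \<in> disk_swap ` ball 0 1"
      using disk_swap_in_ball[OF z] by (rule image_eqI)
  qed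
qed

theorem corollary5p3:
  "\<exists>g. moebius_transformation g \<and> g ` ball 0 1 = ball 0 1 \<and>
     (\<exists>x\<in>ball 0 1. \<exists>y\<in>ball 0 1. apollonian_disk (g x) (g y) \<noteq> apollonian_disk x y)"
proof (intro exI conjI bexI)
  have swap: "disk_swap (1/2) = 0" "disk_swap 0 = 1/2"
    by (simp_all add: disk_swap_def)
  have "apollonian_disk (1/2) 0 \<le> ln (3/2)"
    using apollonian_disk_to_zero_le[of "1/2"] by simp
  \<comment> \<open>The point 1 is the point of the circle nearest to \<open>1/2\<close>, at
    distance \<open>1/2\<close>.\<close>
  moreover have "ln 2 \<le> apollonian_disk 0 (1/2)"
    using apollonian_disk_from_zero_ge[of "1/2" 1] by (simp add: ln_div)
  moreover have "ln (3/2) < ln (2::real)"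
    by simp
  ultimately show "apollonian_disk (disk_swap (1/2)) (disk_swap 0) \<noteq> apollonian_disk (1/2) 0"
    unfolding swap by linarith
qed (simp_all add: moebius_disk_swap disk_swap_image_ball)

end
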